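(* Let $G$ be a locally compact abelian Hausdorff group, $H$ a closed subgroup of $G$, $\varGamma$ the dual group of $G$, and $\varLambda\subseteq\varGamma$ the annihilator of $H$. Let $\mu$ be a regular finite non-negative Borel measure on $\varGamma$ and let $\alpha\in(0,\infty)$. Assume that $\varLambda$ is countable. Then the set $\mathbf{P}(H)$ of trigonometric $H$-polynomials is dense in $L^\alpha(\mu)$ if and only if $\mu$ is concentrated on a transversal.
   Context: All groups are written additively; $\langle\gamma,x\rangle$ denotes the value of the character $\gamma\in\varGamma$ at $x\in G$. The annihilator of $H$ is $\varLambda:=\{\gamma\in\varGamma:\langle\gamma,y\rangle=1 \text{ for all } y\in H\}$, a closed subgroup of $\varGamma$. A trigonometric $H$-polynomial is a function $p:\varGamma\to\mathbb{C}$ that is a finite sum $p(\cdot)=\sum_k a_k\langle\cdot,y_k\rangle$ with $a_k\in\mathbb{C}$, $y_k\in H$; $\mathbf{P}(H)$ is the linear space of all of them. A finite non-negative Borel measure $\mu$ on a Hausdorff space $X$ is regular if for every Borel set $B$ and every $\varepsilon>0$ there are a compact set $C$ and an open set $U$ with $C\subseteq B\subseteq U$ and $\mu(U\setminus C)<\varepsilon$. For $\alpha\in(0,\infty)$, $L^\alpha(\mu)$ is the metric space of ($\mu$-equivalence classes of) Borel measurable functions $f:\varGamma\to\mathbb{C}$ with $\int_\varGamma|f|^\alpha\,d\mu<\infty$, where convergence $f_n\to f$ means $\int_\varGamma|f_n-f|^\alpha\,d\mu\to0$. The measure $\mu$ is said to be concentrated on a transversal if there exists a Borel set $D\subseteq\varGamma$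 such that $\mu(\varGamma\setminus D)=0$ and $D\cap(\lambda+D)=\emptyset$ for all $\lambda\in\varLambda\setminus\{0\}$. *)

theory Defs
  imports "HOL-Analysis.Analysis"
begin

definition add_subgroup :: "'a::ab_group_add set \<Rightarrow> bool" where
  "add_subgroup H \<longleftrightarrow> 0 \<in> H \<and> (\<forall>x\<in>H. \<forall>y\<in>H. x + y \<in> H) \<and> (\<forall>x\<in>H. - x \<in> H)"

text \<open>The dual group of \<open>'a\<close>: the continuous homomorphisms into the unit circle,
  with \<open>pairing \<gamma> x\<close> the value of the character \<open>\<gamma>\<close> at \<open>x\<close>.\<close>

typedef (overloaded) 'a dual =
    "{\<phi> :: 'a::topological_ab_group_add \<Rightarrow> complex.
        continuous_on UNIV \<phi> \<and> (\<forall>x. norm (\<phi> x) = 1) \<and> (\<forall>x y. \<phi> (x + y) = \<phi> x * \<phi> y)}"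
  morphisms pairing Abs_dual
  by (rule exI[of _ "\<lambda>_. 1"]) auto

setup_lifting type_definition_dual

text \<open>Written additively, the group operation is pointwise multiplication of characters.\<close>

instantiation dual :: (topological_ab_group_add) ab_group_add
begin

lift_definition zero_dual :: "'a dual" is "\<lambda>_. 1"
  by simp

lift_definition plus_dual :: "'a dual \<Rightarrow> 'a dual \<Rightarrow> 'a dual" is "\<lambda>\<phi> \<psi> x. \<phi> x * \<psi> x"
  by (auto simp: norm_mult intro!: continuous_intros)

lift_definition uminus_dual :: "'a dual \<Rightarrow> 'a dual" is "\<lambda>\<phi> x. inverse (\<phi> x)"
proof -
  fix \<phi> :: "'a \<Rightarrow> complex"
  assume *: "continuous_on UNIV \<phi> \<and> (\<forall>x. norm (\<phi> x) = 1) \<and> (\<forall>x y. \<phi> (x + y) = \<phi> x * \<phi> y)"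
  then have "\<phi> x \<noteq> 0" for x
    by (metis norm_zero zero_neq_one)
  with * show "continuous_on UNIV (\<lambda>x. inverse (\<phi> x)) \<and> (\<forall>x. norm (inverse (\<phi> x)) = 1) \<and>
      (\<forall>x y. inverse (\<phi> (x + y)) = inverse (\<phi> x) * inverse (\<phi> y))"
    by (simp add: norm_inverse continuous_on_inverse)
qed

definition minus_dual :: "'a dual \<Rightarrow> 'a dual \<Rightarrow> 'a dual" where
  "minus_dual \<gamma> \<delta> = \<gamma> + - \<delta>"

instance
proof
  fix a b c :: "'a dual"
  show "a + b + c = a + (b + c)" by transfer (simp add: mult.assoc)
  show "a + b = b + a" by transfer (simp add: mult.commute)
  show "0 + a = a" by transfer simp
  show "- a + a = 0"
    by transfer (rule ext, metis left_inverse norm_zero zero_neq_one)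
  show "a - b = a + - b" by (rule minus_dual_def)
qed

end

text \<open>The dual group carries the compact-open topology.\<close>

instantiation dual :: (topological_ab_group_add) topological_space
begin

definition open_dual :: "'a dual set \<Rightarrow> bool" where
  "open_dual = generate_topology {{\<gamma>. pairing \<gamma> ` K \<subseteq> U} | K U. compact K \<and> open U}"

instance
proof
  show "open (UNIV :: 'a dual set)"
    unfolding open_dual_def by (rule generate_topology.UNIV)
  show "open (S \<inter> T)" if "open S" "open T" for S T :: "'a dual set"
    using that unfolding open_dual_def by (rule generate_topology.Int)
  show "open (\<Union>K)" if "\<forall>S\<in>K. open S" for K :: "'a dual set set"
    using that unfolding open_dual_def by (intro generate_topology.UN) simp
qed

end

instance dual :: (topological_ab_group_add) t2_space
proof
  fix \<gamma> \<delta> :: "'a dual"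
  assume "\<gamma> \<noteq> \<delta>"
  then have "pairing \<gamma> \<noteq> pairing \<delta>"
    by (simp add: pairing_inject)
  then obtain x where "pairing \<gamma> x \<noteq> pairing \<delta> x"
    by (auto simp only: fun_eq_iff)
  from hausdorff[OF this] obtain U V where UV: "open U" "open V" "pairing \<gamma> x \<in> U" "pairing \<delta> x \<in> V" "U \<inter> V = {}"
    by (elim exE conjE)
  have "open {\<gamma>. pairing \<gamma> ` {x} \<subseteq> W}" if "open W" for W
    unfolding open_dual_def using that by (intro generate_topology.Basis CollectI exI[of _ "{x}"] exI[of _ W]) simp
  from this[OF UV(1)] this[OF UV(2)]
  show "\<exists>U V. open U \<and> open V \<and> \<gamma> \<in> U \<and> \<delta> \<in> V \<and> U \<inter> V = {}"
  proof (intro exI conjI)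
    show "\<gamma> \<in> {\<gamma>. pairing \<gamma> ` {x} \<subseteq> U}" "\<delta> \<in> {\<gamma>. pairing \<gamma> ` {x} \<subseteq> V}"
      using UV by simp_all
    show "{\<gamma>. pairing \<gamma> ` {x} \<subseteq> U} \<inter> {\<gamma>. pairing \<gamma> ` {x} \<subseteq> V} = {}"
      using UV(5) by blast
  qed
qed

definition annihilator :: "'a::topological_ab_group_add set \<Rightarrow> 'a dual set" where
  "annihilator H = {\<gamma>. \<forall>y\<in>H. pairing \<gamma> y = 1}"

definition trig_polynomials :: "'a::topological_ab_group_add set \<Rightarrow> ('a dual \<Rightarrow> complex) set" where
  "trig_polynomials H =
     {p. \<exists>(n::nat) a y. (\<forall>k<n. y k \<in> H) \<and> p = (\<lambda>\<gamma>. \<Sum>k<n. a k * pairing \<gamma> (y k))}"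

definition regular_borel_measure :: "'b::t2_space measure \<Rightarrow> bool" where
  "regular_borel_measure \<mu> \<longleftrightarrow> sets \<mu> = sets borel \<and>
     (\<forall>B\<in>sets borel. \<forall>\<epsilon>>0. \<exists>C U. compact C \<and> open U \<and> C \<subseteq> B \<and> B \<subseteq> U \<and>
        emeasure \<mu> (U - C) < ennreal \<epsilon>)"

text \<open>The elements of \<open>L\<^sup>\<alpha>(\<mu>)\<close> are represented by functions rather than by their
  \<open>\<mu>\<close>-equivalence classes; convergence, and hence density, does not depend on the representative.\<close>

definition Lspace :: "real \<Rightarrow> 'b measure \<Rightarrow> ('b \<Rightarrow> complex) set" where
  "Lspace \<alpha> \<mu> = {f \<in> borel_measurable \<mu>. (\<integral>\<^sup>+x. ennreal (norm (f x) powr \<alpha>) \<partial>\<mu>) < \<infinity>}"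

definition Lconverges :: "real \<Rightarrow> 'b measure \<Rightarrow> (nat \<Rightarrow> 'b \<Rightarrow> complex) \<Rightarrow> ('b \<Rightarrow> complex) \<Rightarrow> bool" where
  "Lconverges \<alpha> \<mu> f g \<longleftrightarrow>
     (\<lambda>n. \<integral>\<^sup>+x. ennreal (norm (f n x - g x) powr \<alpha>) \<partial>\<mu>) \<longlonglongrightarrow> 0"

definition dense_in_Lspace :: "real \<Rightarrow> 'b measure \<Rightarrow> ('b \<Rightarrow> complex) set \<Rightarrow> bool" where
  "dense_in_Lspace \<alpha> \<mu> S \<longleftrightarrow> S \<subseteq> Lspace \<alpha> \<mu> \<and>
     (\<forall>f\<in>Lspace \<alpha> \<mu>. \<exists>p. (\<forall>n. p n \<in> S) \<and> Lconverges \<alpha> \<mu> p f)"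

definition concentrated_on_transversal :: "'b::{ab_group_add, topological_space} set \<Rightarrow> 'b measure \<Rightarrow> bool" where
  "concentrated_on_transversal \<Lambda> \<mu> \<longleftrightarrow>
     (\<exists>D\<in>sets borel. emeasure \<mu> (UNIV - D) = 0 \<and> (\<forall>l\<in>\<Lambda> - {0}. D \<inter> (+) l ` D = {}))"

end

theory Submission
  imports Defs
begin

text \<open>
  Every trigonometric \<open>H\<close>-polynomial is invariant under translation by the annihilator \<open>\<Lambda>\<close>
  of \<open>H\<close>, and, conversely, two characters that agree on \<open>H\<close> differ by an element of \<open>\<Lambda>\<close>.
  Both implications of the theorem come from these two facts.

  If the polynomials are dense, fix \<open>l \<in> \<Lambda>\<close> with \<open>l \<noteq> 0\<close>, a point \<open>x\<close> with \<open>l(x) \<noteq> 1\<close>, and let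
  \<open>g\<close> be the evaluation of characters at \<open>x\<close>. Some sequence of polynomials converges to \<open>g\<close> almost
  everywhere. A point and its translate by \<open>l\<close> cannot both be points of convergence, because the
  limits would agree by invariance, whereas \<open>g\<close> is multiplied by \<open>l(x)\<close> under the translation.
  So there is a Borel set of full measure that is disjoint from its translate by \<open>l\<close>
  (\<open>disjoint_translate_of_dense\<close>). The transversal is the intersection of these sets over \<open>l\<close>, and
  countability of \<open>\<Lambda>\<close> is what makes it Borel and of full measure.

  Conversely, let \<open>\<mu>\<close> be concentrated on a transversal \<open>D\<close>. It suffices to approximate indicator
  functions of Borel sets \<open>B\<close>. Regularity gives compact sets inside \<open>B \<inter> D\<close> and \<open>D - B\<close> that together
  carry almost all of \<open>\<mu>\<close>. On their union \<open>C\<close> the indicator of \<open>B\<close> is continuous, and the polynomials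
  separate the points of \<open>C\<close> because \<open>C \<subseteq> D\<close>. The theorem of Stone and Weierstrass therefore gives a
  polynomial close to the indicator on \<open>C\<close>, but it says nothing about its size off \<open>C\<close>, where a small
  set may still contribute a large integral. This is repaired by composing with a polynomial in one
  real variable that is close to truncation at the level of the given function
  (\<open>trig_polynomial_approximation_compact\<close>): the \<open>H\<close>-polynomials form an algebra, so the composition
  is again one, and it is bounded everywhere by a constant that does not depend on \<open>C\<close>.
\<close>

section \<open>The algebra of trigonometric polynomials\<close>

lemma norm_pairing [simp]: "norm (pairing \<gamma> x) = 1"
  using pairing[of \<gamma>] by simp

lemma pairing_add: "pairing \<gamma> (x + y) = pairing \<gamma> x * pairing \<gamma> y"
  using pairing[of \<gamma>] by simp

lemma pairing_nonzero [simp]: "pairing \<gamma> x \<noteq> 0"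
  by (metis norm_pairing norm_zero zero_neq_one)

lemma pairing_0 [simp]: "pairing \<gamma> 0 = 1"
  using pairing_add[of \<gamma> 0 0] by simp

lemma pairing_minus: "pairing \<gamma> (- x) = cnj (pairing \<gamma> x)"
proof -
  have "pairing \<gamma> x * pairing \<gamma> (- x) = pairing \<gamma> x * cnj (pairing \<gamma> x)"
    using pairing_add[of \<gamma> x "- x"] complex_norm_square[of "pairing \<gamma> x"] by simp
  then show ?thesis by simp
qed

lemma pairing_diff_dual: "pairing (\<gamma> - \<delta>) x = pairing \<gamma> x / pairing \<delta> x"
  unfolding minus_dual_def plus_dual.rep_eq uminus_dual.rep_eq divide_inverse ..

lemma continuous_on_pairing [continuous_intros]: "continuous_on A (\<lambda>\<gamma>. pairing \<gamma> x)"
proof -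
  have "open ((\<lambda>\<gamma>. pairing \<gamma> x) -` U)" if "open U" for U
  proof -
    have "(\<lambda>\<gamma>. pairing \<gamma> x) -` U = {\<gamma>. pairing \<gamma> ` {x} \<subseteq> U}" by auto
    moreover have "open {\<gamma>. pairing \<gamma> ` {x} \<subseteq> U}"
      unfolding open_dual_def using that
      by (intro generate_topology.Basis CollectI exI[of _ "{x}"] exI[of _ U]) simp
    ultimately show ?thesis by simp
  qed
  then have "continuous_on UNIV (\<lambda>\<gamma>. pairing \<gamma> x)"
    by (simp add: continuous_on_open_vimage)
  then show ?thesis
    by (rule continuous_on_subset) simp
qed

lemma trig_polynomials_monomial: "y \<in> H \<Longrightarrow> (\<lambda>\<gamma>. c * pairing \<gamma> y) \<in> trig_polynomials H"
  unfolding trig_polynomials_def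
  by (intro CollectI exI[of _ "1::nat"] exI[of _ "\<lambda>_. c"] exI[of _ "\<lambda>_. y"]) simp

lemma trig_polynomials_add:
  assumes "p \<in> trig_polynomials H" "q \<in> trig_polynomials H"
  shows "(\<lambda>\<gamma>. p \<gamma> + q \<gamma>) \<in> trig_polynomials H"
proof -
  obtain n a y where p: "\<And>k. k < n \<Longrightarrow> y k \<in> H" "p = (\<lambda>\<gamma>. \<Sum>k<n::nat. a k * pairing \<gamma> (y k))"
    using assms(1) unfolding trig_polynomials_def by auto
  obtain m b z where q: "\<And>k. k < m \<Longrightarrow> z k \<in> H" "q = (\<lambda>\<gamma>. \<Sum>k<m::nat. b k * pairing \<gamma> (z k))"
    using assms(2) unfolding trig_polynomials_def by auto
  define c where "c k = (if k < n then a k else b (k - n))" for k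
  define w where "w k = (if k < n then y k else z (k - n))" for k
  have "p \<gamma> + q \<gamma> = (\<Sum>k<n + m. c k * pairing \<gamma> (w k))" for \<gamma>
  proof -
    have "(\<Sum>k<n + m. c k * pairing \<gamma> (w k)) =
        (\<Sum>k<n. c k * pairing \<gamma> (w k)) + (\<Sum>k<m. c (n + k) * pairing \<gamma> (w (n + k)))"
      by (induction m) (simp_all add: add.assoc)
    then show ?thesis by (simp add: p q c_def w_def)
  qed
  moreover have "\<forall>k<n + m. w k \<in> H"
    using p(1) q(1) by (auto simp: w_def)
  ultimately show ?thesis
    unfolding trig_polynomials_def by blast
qed

lemma trig_polynomials_sum:
  assumes "\<And>i. i \<in> I \<Longrightarrow> f i \<in> trig_polynomials H"
  shows "(\<lambda>\<gamma>. \<Sum>i\<in>I. f i \<gamma>) \<in> trig_polynomials H"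
proof -
  have zero: "(\<lambda>_. 0) \<in> trig_polynomials H"
    unfolding trig_polynomials_def by (auto intro!: exI[of _ "0::nat"])
  show ?thesis
  proof (cases "finite I")
    case True
    then show ?thesis
      using assms by induction (auto intro: trig_polynomials_add zero)
  qed (simp add: zero)
qed

lemma trig_polynomials_scale:
  assumes "p \<in> trig_polynomials H"
  shows "(\<lambda>\<gamma>. c * p \<gamma>) \<in> trig_polynomials H"
proof -
  obtain n a y where p: "\<And>k. k < n \<Longrightarrow> y k \<in> H" "p = (\<lambda>\<gamma>. \<Sum>k<n::nat. a k * pairing \<gamma> (y k))"
    using assms unfolding trig_polynomials_def by auto
  have "(\<lambda>\<gamma>. \<Sum>k<n. (c * a k) * pairing \<gamma> (y k)) \<in> trig_polynomials H"
    by (intro trig_polynomials_sum trig_polynomials_monomial) (simp add: p(1))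
  then show ?thesis
    by (simp add: p(2) sum_distrib_left mult.assoc)
qed

lemma trig_polynomials_mult:
  assumes H: "add_subgroup H" and "p \<in> trig_polynomials H" "q \<in> trig_polynomials H"
  shows "(\<lambda>\<gamma>. p \<gamma> * q \<gamma>) \<in> trig_polynomials H"
proof -
  obtain n a y where p: "\<And>k. k < n \<Longrightarrow> y k \<in> H" "p = (\<lambda>\<gamma>. \<Sum>k<n::nat. a k * pairing \<gamma> (y k))"
    using assms(2) unfolding trig_polynomials_def by auto
  obtain m b z where q: "\<And>k. k < m \<Longrightarrow> z k \<in> H" "q = (\<lambda>\<gamma>. \<Sum>k<m::nat. b k * pairing \<gamma> (z k))"
    using assms(3) unfolding trig_polynomials_def by auto
  have "(\<lambda>\<gamma>. \<Sum>i<n. \<Sum>j<m. (a i * b j) * pairing \<gamma> (y i + z j)) \<in> trig_polynomials H"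
    by (intro trig_polynomials_sum trig_polynomials_monomial)
      (use H p(1) q(1) in \<open>auto simp: add_subgroup_def\<close>)
  then show ?thesis
    by (simp add: p(2) q(2) sum_product pairing_add mult.assoc mult.left_commute)
qed

lemma trig_polynomials_const: "add_subgroup H \<Longrightarrow> (\<lambda>_. c) \<in> trig_polynomials H"
  using trig_polynomials_monomial[of 0 H c] by (simp add: add_subgroup_def)

lemma continuous_on_trig_polynomial:
  "p \<in> trig_polynomials H \<Longrightarrow> continuous_on A p"
  unfolding trig_polynomials_def by (auto intro!: continuous_intros)

lemma trig_polynomial_bounded:
  assumes "p \<in> trig_polynomials H"
  obtains B where "\<And>\<gamma>. norm (p \<gamma>) \<le> B"
proof -
  obtain n a y where p: "p = (\<lambda>\<gamma>. \<Sum>k<n::nat. a k * pairing \<gamma> (y k))"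
    using assms unfolding trig_polynomials_def by auto
  have "norm (p \<gamma>) \<le> (\<Sum>k<n. norm (a k))" for \<gamma>
    unfolding p by (rule order_trans[OF norm_sum]) (simp add: norm_mult)
  then show ?thesis by (rule that)
qed

text \<open>The only property of polynomials that the necessity of the transversal rests on.\<close>

lemma trig_polynomial_annihilator_invariant:
  assumes "p \<in> trig_polynomials H" "l \<in> annihilator H"
  shows "p (l + \<gamma>) = p \<gamma>"
  using assms unfolding trig_polynomials_def annihilator_def
  by (auto simp: plus_dual.rep_eq intro!: sum.cong)

section \<open>Uniform approximation on compact sets with a global bound\<close>

text \<open>The theorem of Stone and Weierstrass is a statement about real algebras of functions; the real and
  imaginary parts of a character at \<open>y \<in> H\<close> lie in this one because the conjugate of the
  value of a character at \<open>y\<close> is its value at \<open>- y \<in> H\<close>.\<close>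

definition real_trig_polynomials :: "'a::topological_ab_group_add set \<Rightarrow> ('a dual \<Rightarrow> real) set" where
  "real_trig_polynomials H = {f. (\<lambda>\<gamma>. complex_of_real (f \<gamma>)) \<in> trig_polynomials H}"

lemma real_trig_polynomials_add:
  "f \<in> real_trig_polynomials H \<Longrightarrow> g \<in> real_trig_polynomials H \<Longrightarrow>
    (\<lambda>\<gamma>. f \<gamma> + g \<gamma>) \<in> real_trig_polynomials H"
  unfolding real_trig_polynomials_def by (simp add: trig_polynomials_add)

lemma real_trig_polynomials_mult:
  "add_subgroup H \<Longrightarrow> f \<in> real_trig_polynomials H \<Longrightarrow> g \<in> real_trig_polynomials H \<Longrightarrow>
    (\<lambda>\<gamma>. f \<gamma> * g \<gamma>) \<in> real_trig_polynomials H"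
  unfolding real_trig_polynomials_def by (simp add: trig_polynomials_mult)

lemma real_trig_polynomials_const:
  "add_subgroup H \<Longrightarrow> (\<lambda>_. c) \<in> real_trig_polynomials H"
  by (simp add: real_trig_polynomials_def trig_polynomials_const)

lemma
  assumes H: "add_subgroup H" and y: "y \<in> H"
  shows Re_pairing_real_trig_polynomial: "(\<lambda>\<gamma>. Re (pairing \<gamma> y)) \<in> real_trig_polynomials H"
    and Im_pairing_real_trig_polynomial: "(\<lambda>\<gamma>. Im (pairing \<gamma> y)) \<in> real_trig_polynomials H"
proof -
  have y': "- y \<in> H" using H y by (simp add: add_subgroup_def)
  have "complex_of_real (Re (pairing \<gamma> y)) = 1/2 * pairing \<gamma> y + 1/2 * pairing \<gamma> (- y)"
    "complex_of_real (Im (pairing \<gamma> y)) = - \<i>/2 * pairing \<gamma> y + \<i>/2 * pairing \<gamma> (- y)" for \<gamma>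
    by (simp_all add: complex_eq_iff pairing_minus)
  moreover have "(\<lambda>\<gamma>. a * pairing \<gamma> y + b * pairing \<gamma> (- y)) \<in> trig_polynomials H" for a b
    by (rule trig_polynomials_add[OF trig_polynomials_monomial[OF y] trig_polynomials_monomial[OF y']])
  ultimately show "(\<lambda>\<gamma>. Re (pairing \<gamma> y)) \<in> real_trig_polynomials H"
      "(\<lambda>\<gamma>. Im (pairing \<gamma> y)) \<in> real_trig_polynomials H"
    unfolding real_trig_polynomials_def mem_Collect_eq by presburger+
qed

lemma real_trig_polynomials_compose:
  fixes q :: "real \<Rightarrow> real"
  assumes "add_subgroup H" and "real_polynomial_function q" and r: "r \<in> real_trig_polynomials H"
  shows "(\<lambda>\<gamma>. q (r \<gamma>)) \<in> real_trig_polynomials H"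
  using assms(2)
proof induction
  case (linear f)
  then obtain c where "f = (\<lambda>x. x * c)" unfolding real_bounded_linear by (rule exE)
  then show ?case
    using real_trig_polynomials_mult[OF assms(1) r real_trig_polynomials_const[OF assms(1), of c]] by simp
qed (simp_all add: real_trig_polynomials_add real_trig_polynomials_mult real_trig_polynomials_const assms(1))

text \<open>The point is the last conclusion, a bound on the whole dual group in terms of \<open>M\<close> and \<open>e\<close>
  alone. A first approximation \<open>r\<close> is bounded because it is a trigonometric
  polynomial, but with no control on the bound \<open>B\<close>. Since truncation to \<open>[- M, M]\<close> is continuous
  on \<open>[- B, B]\<close>, it is uniformly close there to a polynomial \<open>q\<close> of one variable. Truncation fixes
  the values of \<open>f\<close> and does not increase distances, so \<open>q \<circ> r\<close> is still close to \<open>f\<close> on \<open>C\<close>.\<close>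

lemma trig_polynomial_approximation_compact:
  fixes f :: "'a::topological_ab_group_add dual \<Rightarrow> real"
  assumes H: "add_subgroup H" and C: "compact C"
    and sep: "\<And>\<gamma> \<delta>. \<gamma> \<in> C \<Longrightarrow> \<delta> \<in> C \<Longrightarrow> \<gamma> \<noteq> \<delta> \<Longrightarrow> \<gamma> - \<delta> \<notin> annihilator H"
    and f: "continuous_on C f" and M: "\<And>\<gamma>. \<gamma> \<in> C \<Longrightarrow> \<bar>f \<gamma>\<bar> \<le> M" "0 \<le> M" and e: "0 < e"
  obtains p where "p \<in> real_trig_polynomials H"
    and "\<And>\<gamma>. \<gamma> \<in> C \<Longrightarrow> \<bar>f \<gamma> - p \<gamma>\<bar> < e" and "\<And>\<gamma>. \<bar>p \<gamma>\<bar> \<le> M + e"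
proof -
  interpret function_ring_on "real_trig_polynomials H" C
  proof
    show "continuous_on C g" if "g \<in> real_trig_polynomials H" for g
    proof -
      have "continuous_on C (\<lambda>\<gamma>. Re (complex_of_real (g \<gamma>)))"
        using that unfolding real_trig_polynomials_def
        by (intro continuous_on_Re continuous_on_trig_polynomial) simp
      then show ?thesis by simp
    qed
    show "\<exists>g\<in>real_trig_polynomials H. g \<gamma> \<noteq> g \<delta>" if neq: "\<gamma> \<in> C" "\<delta> \<in> C" "\<gamma> \<noteq> \<delta>" for \<gamma> \<delta>
    proof -
      obtain y where y: "y \<in> H" "pairing \<gamma> y \<noteq> pairing \<delta> y"
        using sep[OF neq] by (auto simp: annihilator_def pairing_diff_dual)
      then have "Re (pairing \<gamma> y) \<noteq> Re (pairing \<delta> y) \<or> Im (pairing \<gamma> y) \<noteq> Im (pairing \<delta> y)"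
        by (simp add: complex_eq_iff)
      then show ?thesis
        using Re_pairing_real_trig_polynomial[OF H y(1)] Im_pairing_real_trig_polynomial[OF H y(1)]
        by (elim disjE) (rule bexI, assumption, assumption)+
    qed
  qed (simp_all add: C real_trig_polynomials_add real_trig_polynomials_mult[OF H]
      real_trig_polynomials_const[OF H])
  obtain r where r: "r \<in> real_trig_polynomials H" "\<And>\<gamma>. \<gamma> \<in> C \<Longrightarrow> \<bar>f \<gamma> - r \<gamma>\<bar> < e / 2"
    using Stone_Weierstrass_basic[OF f half_gt_zero[OF e]] by blast
  have "(\<lambda>\<gamma>. complex_of_real (r \<gamma>)) \<in> trig_polynomials H"
    using r(1) by (simp add: real_trig_polynomials_def)
  then obtain B where r_le: "\<And>\<gamma>. norm (complex_of_real (r \<gamma>)) \<le> B"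
    by (rule trig_polynomial_bounded) blast
  have B: "r \<gamma> \<in> {- B..B}" for \<gamma>
  proof -
    have "\<bar>r \<gamma>\<bar> \<le> B" using r_le[of \<gamma>] by simp
    then show ?thesis unfolding atLeastAtMost_iff by linarith
  qed
  define t where "t x = max (- M) (min M x)" for x :: real
  have "continuous_on {- B..B} t"
    unfolding t_def by (intro continuous_intros)
  then obtain q where q: "real_polynomial_function q" "\<And>x. x \<in> {- B..B} \<Longrightarrow> \<bar>t x - q x\<bar> < e / 2"
    using Stone_Weierstrass_real_polynomial_function[OF compact_Icc _ half_gt_zero[OF e]] by blast
  show ?thesis
  proof
    show "(\<lambda>\<gamma>. q (r \<gamma>)) \<in> real_trig_polynomials H"
      by (rule real_trig_polynomials_compose[OF H q(1) r(1)])
    show "\<bar>q (r \<gamma>)\<bar> \<le> M + e" for \<gamma>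
    proof -
      have "\<bar>t (r \<gamma>)\<bar> \<le> M" using M(2) unfolding t_def by linarith
      then show ?thesis using q(2)[OF B[of \<gamma>]] e by linarith
    qed
    show "\<bar>f \<gamma> - q (r \<gamma>)\<bar> < e" if "\<gamma> \<in> C" for \<gamma>
    proof -
      have "\<bar>f \<gamma> - t (r \<gamma>)\<bar> \<le> \<bar>f \<gamma> - r \<gamma>\<bar>"
        using M(1)[OF that] M(2) unfolding t_def by linarith
      then show ?thesis
        using q(2)[OF B[of \<gamma>]] r(2)[OF that] by linarith
    qed
  qed
qed

section \<open>Approximation in the mean of order \<open>\<alpha>\<close>\<close>

text \<open>The \<open>\<alpha>\<close>-th power of the \<open>L\<^sup>\<alpha>\<close> norm; it stays meaningful for \<open>\<alpha> < 1\<close>, where that norm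
  is only a quasi-norm.\<close>

definition Lpow :: "real \<Rightarrow> 'b measure \<Rightarrow> ('b \<Rightarrow> complex) \<Rightarrow> ennreal" where
  "Lpow \<alpha> \<mu> f = (\<integral>\<^sup>+x. ennreal (norm (f x) powr \<alpha>) \<partial>\<mu>)"

text \<open>A quasi-triangle inequality that covers the cases \<open>\<alpha> \<le> 1\<close> and \<open>\<alpha> \<ge> 1\<close> at once, from
  \<open>\<bar>u + v\<bar> \<le> 2 max (\<bar>u\<bar>, \<bar>v\<bar>)\<close>. The constant is harmless, since errors are only ever added a
  bounded number of times.\<close>

lemma Lpow_add_le:
  assumes [measurable]: "f \<in> borel_measurable \<mu>" "g \<in> borel_measurable \<mu>" and \<alpha>: "0 < \<alpha>"
  shows "Lpow \<alpha> \<mu> (\<lambda>x. f x + g x) \<le> ennreal (2 powr \<alpha>) * (Lpow \<alpha> \<mu> f + Lpow \<alpha> \<mu> g)"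
proof -
  have "norm (u + v) powr \<alpha> \<le> 2 powr \<alpha> * (norm u powr \<alpha> + norm v powr \<alpha>)" for u v :: complex
  proof -
    have "norm (u + v) powr \<alpha> \<le> (2 * max (norm u) (norm v)) powr \<alpha>"
      by (rule powr_mono2) (use \<alpha> norm_triangle_ineq[of u v] in auto)
    also have "\<dots> = 2 powr \<alpha> * max (norm u) (norm v) powr \<alpha>"
      by (rule powr_mult)
    also have "\<dots> \<le> 2 powr \<alpha> * (norm u powr \<alpha> + norm v powr \<alpha>)"
      by (intro mult_left_mono) (auto simp: max_def)
    finally show ?thesis .
  qed
  then have "Lpow \<alpha> \<mu> (\<lambda>x. f x + g x) \<le>
      (\<integral>\<^sup>+x. ennreal (2 powr \<alpha>) * (ennreal (norm (f x) powr \<alpha>) + ennreal (norm (g x) powr \<alpha>)) \<partial>\<mu>)"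
    unfolding Lpow_def
    by (intro nn_integral_mono) (simp flip: ennreal_mult ennreal_plus)
  also have "\<dots> = ennreal (2 powr \<alpha>) * (Lpow \<alpha> \<mu> f + Lpow \<alpha> \<mu> g)"
    unfolding Lpow_def by (subst nn_integral_cmult) (simp_all add: nn_integral_add)
  finally show ?thesis .
qed

lemma Lpow_scale:
  assumes [measurable]: "f \<in> borel_measurable \<mu>"
  shows "Lpow \<alpha> \<mu> (\<lambda>x. c * f x) = ennreal (norm c powr \<alpha>) * Lpow \<alpha> \<mu> f"
  unfolding Lpow_def by (simp add: norm_mult powr_mult ennreal_mult nn_integral_cmult)

definition Lclosure :: "real \<Rightarrow> 'b measure \<Rightarrow> ('b \<Rightarrow> complex) set \<Rightarrow> ('b \<Rightarrow> complex) set" where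
  "Lclosure \<alpha> \<mu> S =
    {f \<in> borel_measurable \<mu>. \<forall>e>0. \<exists>p\<in>S. Lpow \<alpha> \<mu> (\<lambda>x. f x - p x) < ennreal e}"

lemma dense_in_LspaceI:
  assumes "S \<subseteq> Lspace \<alpha> \<mu>" and cl: "Lspace \<alpha> \<mu> \<subseteq> Lclosure \<alpha> \<mu> S"
  shows "dense_in_Lspace \<alpha> \<mu> S"
  unfolding dense_in_Lspace_def
proof (intro conjI ballI)
  fix f assume "f \<in> Lspace \<alpha> \<mu>"
  then have "\<forall>n. \<exists>p\<in>S. Lpow \<alpha> \<mu> (\<lambda>x. f x - p x) < ennreal (inverse (real (Suc n)))"
    using cl unfolding Lclosure_def by fastforce
  then obtain p where p: "\<And>n. p n \<in> S"
      "\<And>n. Lpow \<alpha> \<mu> (\<lambda>x. f x - p n x) < ennreal (inverse (real (Suc n)))"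
    by metis
  have "(\<lambda>n. ennreal (inverse (real (Suc n)))) \<longlonglongrightarrow> ennreal 0"
    by (intro tendsto_ennrealI LIMSEQ_inverse_real_of_nat)
  then have "(\<lambda>n. Lpow \<alpha> \<mu> (\<lambda>x. f x - p n x)) \<longlonglongrightarrow> 0"
    unfolding ennreal_0
    by (rule tendsto_sandwich[OF _ _ tendsto_const, rotated 2])
      (auto intro!: always_eventually less_imp_le[OF p(2)] simp del: of_nat_Suc)
  then have "Lconverges \<alpha> \<mu> p f"
    by (simp add: Lconverges_def Lpow_def norm_minus_commute)
  with p(1) show "\<exists>p. (\<forall>n. p n \<in> S) \<and> Lconverges \<alpha> \<mu> p f" by blast
qed fact

lemma Lclosure_add:
  assumes \<alpha>: "0 < \<alpha>" and S: "S \<subseteq> borel_measurable \<mu>"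
    and S_add: "\<And>p q. p \<in> S \<Longrightarrow> q \<in> S \<Longrightarrow> (\<lambda>x. p x + q x) \<in> S"
    and f: "f \<in> Lclosure \<alpha> \<mu> S" and g: "g \<in> Lclosure \<alpha> \<mu> S"
  shows "(\<lambda>x. f x + g x) \<in> Lclosure \<alpha> \<mu> S"
  unfolding Lclosure_def
proof (intro CollectI conjI allI impI)
  have [measurable]: "f \<in> borel_measurable \<mu>" "g \<in> borel_measurable \<mu>"
    using f g by (auto simp: Lclosure_def)
  show "(\<lambda>x. f x + g x) \<in> borel_measurable \<mu>" by measurable
  fix e :: real assume e: "0 < e"
  define d where "d = e / (2 powr \<alpha> * 2)"
  have "0 < d" using e by (simp add: d_def)
  then obtain p q where p: "p \<in> S" "Lpow \<alpha> \<mu> (\<lambda>x. f x - p x) < ennreal d"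
      and q: "q \<in> S" "Lpow \<alpha> \<mu> (\<lambda>x. g x - q x) < ennreal d"
    using f g unfolding Lclosure_def by blast
  have [measurable]: "p \<in> borel_measurable \<mu>" "q \<in> borel_measurable \<mu>"
    using S p q by auto
  have "Lpow \<alpha> \<mu> (\<lambda>x. f x + g x - (p x + q x)) = Lpow \<alpha> \<mu> (\<lambda>x. (f x - p x) + (g x - q x))"
    by (simp add: algebra_simps)
  also have "\<dots> \<le> ennreal (2 powr \<alpha>) * (Lpow \<alpha> \<mu> (\<lambda>x. f x - p x) + Lpow \<alpha> \<mu> (\<lambda>x. g x - q x))"
    by (rule Lpow_add_le) (use \<alpha> in measurable)
  also have "\<dots> < ennreal (2 powr \<alpha>) * (ennreal d + ennreal d)"
    by (intro ennreal_mult_strict_left_mono add_strict_mono p q) auto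
  also have "\<dots> = ennreal e"
    using \<open>0 < d\<close> by (simp add: d_def flip: ennreal_mult ennreal_plus)
  finally show "\<exists>p\<in>S. Lpow \<alpha> \<mu> (\<lambda>x. f x + g x - p x) < ennreal e"
    by (intro bexI[OF _ S_add[OF p(1) q(1)]])
qed

lemma Lclosure_scale:
  assumes S: "S \<subseteq> borel_measurable \<mu>"
    and S_scale: "\<And>p c. p \<in> S \<Longrightarrow> (\<lambda>x. c * p x) \<in> S"
    and f: "f \<in> Lclosure \<alpha> \<mu> S"
  shows "(\<lambda>x. c * f x) \<in> Lclosure \<alpha> \<mu> S"
  unfolding Lclosure_def
proof (intro CollectI conjI allI impI)
  have [measurable]: "f \<in> borel_measurable \<mu>"
    using f by (auto simp: Lclosure_def)
  show "(\<lambda>x. c * f x) \<in> borel_measurable \<mu>" by measurable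
  fix e :: real assume e: "0 < e"
  define K where "K = norm c powr \<alpha> + 1"
  have K: "0 < K" by (simp add: K_def add_nonneg_pos)
  then obtain p where p: "p \<in> S" "Lpow \<alpha> \<mu> (\<lambda>x. f x - p x) < ennreal (e / K)"
    using f e unfolding Lclosure_def by (auto dest!: spec[of _ "e / K"])
  have [measurable]: "p \<in> borel_measurable \<mu>"
    using S p by auto
  have "Lpow \<alpha> \<mu> (\<lambda>x. c * f x - c * p x) = ennreal (norm c powr \<alpha>) * Lpow \<alpha> \<mu> (\<lambda>x. f x - p x)"
    by (subst Lpow_scale[symmetric]) (simp_all add: algebra_simps)
  also have "\<dots> \<le> ennreal K * Lpow \<alpha> \<mu> (\<lambda>x. f x - p x)"
    by (intro mult_right_mono) (auto simp: K_def)
  also have "\<dots> < ennreal K * ennreal (e / K)"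
    using K by (intro ennreal_mult_strict_left_mono p) auto
  also have "\<dots> = ennreal e"
    using K e by (simp flip: ennreal_mult)
  finally show "\<exists>p\<in>S. Lpow \<alpha> \<mu> (\<lambda>x. c * f x - p x) < ennreal e"
    by (intro bexI[OF _ S_scale[OF p(1), of c]])
qed

text \<open>A measurable function is a pointwise limit of simple functions of at most twice its modulus, so
  the differences are dominated by three times the modulus and dominated convergence applies.\<close>

lemma Lspace_subset_Lclosure_simple:
  assumes \<alpha>: "0 < \<alpha>" and S: "S \<subseteq> borel_measurable \<mu>"
    and simple: "\<And>s. simple_function \<mu> s \<Longrightarrow> s \<in> Lclosure \<alpha> \<mu> S"
  shows "Lspace \<alpha> \<mu> \<subseteq> Lclosure \<alpha> \<mu> S"
proof
  fix f assume f: "f \<in> Lspace \<alpha> \<mu>"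
  then have [measurable]: "f \<in> borel_measurable \<mu>" by (simp add: Lspace_def)
  obtain s where "\<forall>i. simple_function \<mu> (s i)" "\<forall>x\<in>space \<mu>. (\<lambda>i. s i x) \<longlonglongrightarrow> f x"
      "\<forall>i. \<forall>x\<in>space \<mu>. dist (s i x) 0 \<le> 2 * dist (f x) 0"
    using borel_measurable_implies_sequence_metric[OF \<open>f \<in> borel_measurable \<mu>\<close>, of 0] by blast
  then have s: "\<And>i. simple_function \<mu> (s i)"
      "\<And>x. x \<in> space \<mu> \<Longrightarrow> (\<lambda>i. s i x) \<longlonglongrightarrow> f x"
      "\<And>i x. x \<in> space \<mu> \<Longrightarrow> norm (s i x) \<le> 2 * norm (f x)"
    by (auto simp: dist_norm)
  have [measurable]: "s i \<in> borel_measurable \<mu>" for i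
    by (rule borel_measurable_simple_function[OF s(1)])
  have "(\<lambda>i. Lpow \<alpha> \<mu> (\<lambda>x. f x - s i x)) \<longlonglongrightarrow> (\<integral>\<^sup>+x. 0 \<partial>\<mu>)"
    unfolding Lpow_def
  proof (rule nn_integral_dominated_convergence[where w = "\<lambda>x. ennreal (3 powr \<alpha>) * ennreal (norm (f x) powr \<alpha>)"])
    show "AE x in \<mu>. ennreal (norm (f x - s i x) powr \<alpha>) \<le> ennreal (3 powr \<alpha>) * ennreal (norm (f x) powr \<alpha>)" for i
    proof (rule AE_I2)
      fix x assume "x \<in> space \<mu>"
      then have "norm (f x - s i x) \<le> 3 * norm (f x)"
        using s(3)[of x i] norm_triangle_ineq4[of "f x" "s i x"] by simp
      then have "norm (f x - s i x) powr \<alpha> \<le> (3 * norm (f x)) powr \<alpha>"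
        using \<alpha> by (intro powr_mono2) auto
      then show "ennreal (norm (f x - s i x) powr \<alpha>) \<le> ennreal (3 powr \<alpha>) * ennreal (norm (f x) powr \<alpha>)"
        by (simp add: powr_mult flip: ennreal_mult)
    qed
    show "(\<integral>\<^sup>+x. ennreal (3 powr \<alpha>) * ennreal (norm (f x) powr \<alpha>) \<partial>\<mu>) < \<infinity>"
      using f by (simp add: Lspace_def nn_integral_cmult ennreal_mult_less_top)
    show "AE x in \<mu>. (\<lambda>i. ennreal (norm (f x - s i x) powr \<alpha>)) \<longlonglongrightarrow> 0"
    proof (rule AE_I2)
      fix x assume "x \<in> space \<mu>"
      then have "(\<lambda>i. norm (f x - s i x)) \<longlonglongrightarrow> norm (f x - f x)"
        by (intro tendsto_intros s(2))
      then have "(\<lambda>i. norm (f x - s i x) powr \<alpha>) \<longlonglongrightarrow> 0 powr \<alpha>"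
        using \<alpha> by (intro tendsto_powr') auto
      then show "(\<lambda>i. ennreal (norm (f x - s i x) powr \<alpha>)) \<longlonglongrightarrow> 0"
        using tendsto_ennrealI by fastforce
    qed
  qed auto
  then have lim: "(\<lambda>i. Lpow \<alpha> \<mu> (\<lambda>x. f x - s i x)) \<longlonglongrightarrow> 0" by simp
  show "f \<in> Lclosure \<alpha> \<mu> S"
    unfolding Lclosure_def
  proof (intro CollectI conjI allI impI)
    fix e :: real assume e: "0 < e"
    define d where "d = e / (2 powr \<alpha> * 2)"
    have "0 < d" using e by (simp add: d_def)
    then have "0 < ennreal d" by simp
    then obtain i where i: "Lpow \<alpha> \<mu> (\<lambda>x. f x - s i x) < ennreal d"
      using order_tendstoD(2)[OF lim] by (meson eventually_happens sequentially_bot)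
    obtain p where p: "p \<in> S" "Lpow \<alpha> \<mu> (\<lambda>x. s i x - p x) < ennreal d"
      using simple[OF s(1)] \<open>0 < d\<close> unfolding Lclosure_def by blast
    have [measurable]: "p \<in> borel_measurable \<mu>"
      using S p by auto
    have "Lpow \<alpha> \<mu> (\<lambda>x. f x - p x) = Lpow \<alpha> \<mu> (\<lambda>x. (f x - s i x) + (s i x - p x))"
      by simp
    also have "\<dots> \<le> ennreal (2 powr \<alpha>) * (Lpow \<alpha> \<mu> (\<lambda>x. f x - s i x) + Lpow \<alpha> \<mu> (\<lambda>x. s i x - p x))"
      by (rule Lpow_add_le) (use \<alpha> in measurable)
    also have "\<dots> < ennreal (2 powr \<alpha>) * (ennreal d + ennreal d)"
      by (intro ennreal_mult_strict_left_mono add_strict_mono i p) auto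
    also have "\<dots> = ennreal e"
      using \<open>0 < d\<close> by (simp add: d_def flip: ennreal_mult ennreal_plus)
    finally show "\<exists>p\<in>S. Lpow \<alpha> \<mu> (\<lambda>x. f x - p x) < ennreal e"
      using p(1) by blast
  qed measurable
qed

text \<open>Simple functions are finite linear combinations of indicators, and the closure of a linear
  space is linear.\<close>

lemma Lspace_subset_Lclosure_indicator:
  assumes \<alpha>: "0 < \<alpha>" and S: "S \<subseteq> borel_measurable \<mu>"
    and S_add: "\<And>p q. p \<in> S \<Longrightarrow> q \<in> S \<Longrightarrow> (\<lambda>x. p x + q x) \<in> S"
    and S_scale: "\<And>p c. p \<in> S \<Longrightarrow> (\<lambda>x. c * p x) \<in> S"
    and ind: "\<And>B. B \<in> sets \<mu> \<Longrightarrow> indicator B \<in> Lclosure \<alpha> \<mu> S"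
  shows "Lspace \<alpha> \<mu> \<subseteq> Lclosure \<alpha> \<mu> S"
proof (rule Lspace_subset_Lclosure_simple[OF \<alpha> S])
  fix s :: "'a \<Rightarrow> complex" assume s: "simple_function \<mu> s"
  have zero: "(\<lambda>_. 0) \<in> Lclosure \<alpha> \<mu> S"
    using Lclosure_scale[OF S _ ind[OF sets.empty_sets], of 0] S_scale by simp
  have "finite I \<Longrightarrow> (\<lambda>x. \<Sum>v\<in>I. v * indicator (s -` {v} \<inter> space \<mu>) x) \<in> Lclosure \<alpha> \<mu> S" for I
  proof (induction rule: finite_induct)
    case (insert v I)
    have "s -` {v} \<inter> space \<mu> \<in> sets \<mu>" by (rule simple_functionD(2)[OF s])
    then have v: "(\<lambda>x. v * indicator (s -` {v} \<inter> space \<mu>) x) \<in> Lclosure \<alpha> \<mu> S"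
      by (intro Lclosure_scale[OF S] S_scale ind)
    show ?case
      unfolding sum.insert[OF insert.hyps]
      by (rule Lclosure_add[OF \<alpha> S _ v insert.IH]) (erule (1) S_add)
  qed (simp add: zero)
  from this[OF simple_functionD(1)[OF s]]
  have mem: "(\<lambda>x. \<Sum>v\<in>s ` space \<mu>. v * indicator (s -` {v} \<inter> space \<mu>) x) \<in> Lclosure \<alpha> \<mu> S" .
  have eq: "(\<Sum>v\<in>s ` space \<mu>. v * indicator (s -` {v} \<inter> space \<mu>) x) = s x" if "x \<in> space \<mu>" for x
  proof -
    have "(\<Sum>v\<in>s ` space \<mu>. v * indicator (s -` {v} \<inter> space \<mu>) x) = (\<Sum>v\<in>{s x}. v)"
      by (rule sum.mono_neutral_cong_right)
        (use that simple_functionD(1)[OF s] in \<open>auto simp: indicator_def\<close>)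
    then show ?thesis by simp
  qed
  show "s \<in> Lclosure \<alpha> \<mu> S"
    using mem borel_measurable_simple_function[OF s]
    by (simp add: Lclosure_def Lpow_def eq cong: nn_integral_cong)
qed

lemma bounded_measurable_in_Lspace:
  assumes "finite_measure \<mu>" and f: "f \<in> borel_measurable \<mu>" and B: "\<And>x. norm (f x) \<le> B" and \<alpha>: "0 < \<alpha>"
  shows "f \<in> Lspace \<alpha> \<mu>"
proof -
  interpret finite_measure \<mu> by fact
  have "(\<integral>\<^sup>+x. ennreal (norm (f x) powr \<alpha>) \<partial>\<mu>) \<le> (\<integral>\<^sup>+x. ennreal (B powr \<alpha>) \<partial>\<mu>)"
    by (intro nn_integral_mono ennreal_leI powr_mono2) (use B \<alpha> in auto)
  also have "\<dots> < \<infinity>"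
    by (simp add: ennreal_mult_less_top emeasure_eq_measure)
  finally show ?thesis using f by (simp add: Lspace_def)
qed

lemma trig_polynomials_subset_Lspace:
  fixes \<mu> :: "'a::topological_ab_group_add dual measure"
  assumes "finite_measure \<mu>" and sets: "sets \<mu> = sets borel" and "0 < \<alpha>"
  shows "trig_polynomials H \<subseteq> Lspace \<alpha> \<mu>"
proof
  fix p assume p: "p \<in> trig_polynomials H"
  have "p \<in> borel_measurable \<mu>"
    using borel_measurable_continuous_onI[OF continuous_on_trig_polynomial[OF p]]
    by (simp add: measurable_cong_sets[OF sets refl])
  then show "p \<in> Lspace \<alpha> \<mu>"
    using trig_polynomial_bounded[OF p] bounded_measurable_in_Lspace assms by metis
qed

text \<open>The integral of the error splits into a part over the compact set \<open>C\<close>, where the approximation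
  is uniformly good, and a part over its complement, which has small measure and on which the error
  is at most \<open>1 + 2\<close> thanks to the global bound on the polynomial.\<close>

lemma indicator_in_Lclosure_trig_polynomials:
  fixes \<mu> :: "'a::topological_ab_group_add dual measure"
  assumes H: "add_subgroup H" and "finite_measure \<mu>" and reg: "regular_borel_measure \<mu>"
    and \<alpha>: "0 < \<alpha>"
    and D: "D \<in> sets borel" "emeasure \<mu> (UNIV - D) = 0"
      "\<And>l. l \<in> annihilator H \<Longrightarrow> l \<noteq> 0 \<Longrightarrow> D \<inter> (+) l ` D = {}"
    and B: "B \<in> sets \<mu>"
  shows "indicator B \<in> Lclosure \<alpha> \<mu> (trig_polynomials H)"
  unfolding Lclosure_def
proof (intro CollectI conjI allI impI)
  interpret finite_measure \<mu> by fact
  have sets [measurable_cong]: "sets \<mu> = sets borel"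
    using reg by (simp add: regular_borel_measure_def)
  have space: "space \<mu> = UNIV" using sets_eq_imp_space_eq[OF sets] by simp
  show "indicator B \<in> borel_measurable \<mu>" using B by measurable
  fix e :: real assume e: "0 < e"
  define M where "M = measure \<mu> UNIV"
  have M: "0 \<le> M" "emeasure \<mu> UNIV = ennreal M"
    by (simp_all add: M_def emeasure_eq_measure)
  \<comment> \<open>The uniform error on \<open>C\<close>: its \<open>\<alpha>\<close>-th power times the total mass \<open>M\<close> is at most \<open>e / 3\<close>.
    The summand \<open>1\<close> in \<open>M + 1\<close> allows for the zero measure, and \<open>\<eta> \<le> 1\<close> bounds the polynomial by \<open>2\<close>.\<close>
  define \<eta> where "\<eta> = min 1 ((e / (3 * (M + 1))) powr (1 / \<alpha>))"
  have \<eta>: "0 < \<eta>" "\<eta> \<le> 1" using e M by (auto simp: \<eta>_def)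
  have "\<eta> powr \<alpha> \<le> ((e / (3 * (M + 1))) powr (1 / \<alpha>)) powr \<alpha>"
    using \<alpha> \<eta> by (intro powr_mono2) (auto simp: \<eta>_def)
  also have "\<dots> = e / (3 * (M + 1))"
    using \<alpha> e M by (simp add: powr_powr)
  finally have "\<eta> powr \<alpha> * M \<le> e / (3 * (M + 1)) * M"
    using M by (intro mult_right_mono) auto
  also have "\<dots> \<le> e / 3"
    using M e by (simp add: field_simps)
  finally have \<eta>_M: "\<eta> powr \<alpha> * M \<le> e / 3" .
  \<comment> \<open>Two exceptional sets of mass \<open>d\<close>, each with error at most \<open>3\<close>, contribute another \<open>e / 3\<close>.\<close>
  define d where "d = e / (6 * 3 powr \<alpha>)"
  have d: "0 < d" using e by (simp add: d_def)
  have Bb: "B \<in> sets borel" using B sets by simp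
  have "\<exists>C. compact C \<and> C \<subseteq> A \<and> emeasure \<mu> (A - C) < ennreal d" if A: "A \<in> sets borel" for A
  proof -
    obtain C U where CU: "compact C" "open U" "C \<subseteq> A" "A \<subseteq> U" "emeasure \<mu> (U - C) < ennreal d"
      using reg[unfolded regular_borel_measure_def, THEN conjunct2, rule_format, OF A d] by blast
    have "emeasure \<mu> (A - C) \<le> emeasure \<mu> (U - C)"
      using CU by (intro emeasure_mono) (auto simp: sets borel_compact)
    also have "\<dots> < ennreal d" by (rule CU(5))
    finally show ?thesis using CU(1,3) by blast
  qed
  from this[OF sets.Int[OF Bb D(1)]] this[OF sets.Diff[OF D(1) Bb]] obtain C1 C2 where
    C1: "compact C1" "C1 \<subseteq> B \<inter> D" "emeasure \<mu> (B \<inter> D - C1) < ennreal d" and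
    C2: "compact C2" "C2 \<subseteq> D - B" "emeasure \<mu> (D - B - C2) < ennreal d"
    by blast
  define C where "C = C1 \<union> C2"
  have C: "compact C" "C \<subseteq> D" using C1 C2 by (auto simp: C_def)
  have [measurable]: "C \<in> sets \<mu>" "C1 \<in> sets \<mu>" "C2 \<in> sets \<mu>" "D \<in> sets \<mu>"
    using C C1 C2 D by (auto simp: sets borel_compact)
  note [measurable] = B
  have sep: "\<gamma> - \<delta> \<notin> annihilator H" if "\<gamma> \<in> C" "\<delta> \<in> C" "\<gamma> \<noteq> \<delta>" for \<gamma> \<delta>
  proof
    assume "\<gamma> - \<delta> \<in> annihilator H"
    from D(3)[OF this] that have "D \<inter> (+) (\<gamma> - \<delta>) ` D = {}" by simp
    moreover have "\<gamma> \<in> (+) (\<gamma> - \<delta>) ` D" using that C by (intro image_eqI[of _ _ \<delta>]) auto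
    ultimately show False using that C by blast
  qed
  have "continuous_on C (indicator B :: _ \<Rightarrow> real)"
  proof -
    have "continuous_on C1 (indicator B :: _ \<Rightarrow> real)"
      by (rule continuous_on_eq[OF continuous_on_const[of _ 1]]) (use C1(2) in auto)
    moreover have "continuous_on C2 (indicator B :: _ \<Rightarrow> real)"
      by (rule continuous_on_eq[OF continuous_on_const[of _ 0]]) (use C2(2) in auto)
    ultimately show ?thesis
      unfolding C_def using C1(1) C2(1) by (intro continuous_on_closed_Un compact_imp_closed)
  qed
  then obtain p where p: "p \<in> real_trig_polynomials H"
      "\<And>\<gamma>. \<gamma> \<in> C \<Longrightarrow> \<bar>indicator B \<gamma> - p \<gamma>\<bar> < \<eta>" "\<And>\<gamma>. \<bar>p \<gamma>\<bar> \<le> 1 + \<eta>"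
    using trig_polynomial_approximation_compact[OF H C(1) sep _ _ _ \<eta>(1), of "indicator B" 1]
    by (auto simp: indicator_def)
  have bound: "norm (indicator B \<gamma> - complex_of_real (p \<gamma>)) powr \<alpha>
      \<le> \<eta> powr \<alpha> + 3 powr \<alpha> * indicator (UNIV - C) \<gamma>" for \<gamma>
  proof -
    have "indicator B \<gamma> - complex_of_real (p \<gamma>) = complex_of_real (indicator B \<gamma> - p \<gamma>)"
      by (simp add: indicator_def)
    then have n: "norm (indicator B \<gamma> - complex_of_real (p \<gamma>)) = \<bar>indicator B \<gamma> - p \<gamma>\<bar>"
      by (simp only: norm_of_real)
    have "\<bar>indicator B \<gamma> - p \<gamma>\<bar> powr \<alpha> \<le> \<eta> powr \<alpha>" if "\<gamma> \<in> C"
      using p(2)[OF that] \<alpha> by (intro powr_mono2) auto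
    moreover have "\<bar>indicator B \<gamma> - p \<gamma>\<bar> powr \<alpha> \<le> 3 powr \<alpha>"
      using p(3)[of \<gamma>] \<eta> \<alpha> by (intro powr_mono2) (auto simp: indicator_def)
    ultimately show ?thesis
      unfolding n by (auto simp: indicator_def intro: add_increasing)
  qed
  have "emeasure \<mu> (UNIV - C) \<le> emeasure \<mu> ((UNIV - D) \<union> ((B \<inter> D - C1) \<union> (D - B - C2)))"
    using C1(2) C2(2) by (intro emeasure_mono) (auto simp: C_def space[symmetric])
  also have "\<dots> \<le> emeasure \<mu> (UNIV - D) + (emeasure \<mu> (B \<inter> D - C1) + emeasure \<mu> (D - B - C2))"
    by (intro order_trans[OF emeasure_subadditive] add_left_mono)
      (auto simp: space[symmetric] intro!: emeasure_subadditive)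
  also have "\<dots> \<le> 0 + (ennreal d + ennreal d)"
    using C1(3) C2(3) D(2) by (intro add_mono) auto
  finally have C_compl: "emeasure \<mu> (UNIV - C) \<le> ennreal (2 * d)"
    using d by (simp flip: ennreal_plus)
  have "Lpow \<alpha> \<mu> (\<lambda>\<gamma>. indicator B \<gamma> - complex_of_real (p \<gamma>)) \<le>
      (\<integral>\<^sup>+\<gamma>. ennreal (\<eta> powr \<alpha>) + ennreal (3 powr \<alpha>) * indicator (UNIV - C) \<gamma> \<partial>\<mu>)"
    unfolding Lpow_def
    by (intro nn_integral_mono order_trans[OF ennreal_leI[OF bound]])
      (auto simp: indicator_def simp flip: ennreal_plus)
  also have "\<dots> = ennreal (\<eta> powr \<alpha>) * emeasure \<mu> UNIV + ennreal (3 powr \<alpha>) * emeasure \<mu> (UNIV - C)"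
    by (subst nn_integral_add) (auto simp: nn_integral_cmult_indicator space[symmetric])
  also have "\<dots> \<le> ennreal (\<eta> powr \<alpha>) * ennreal M + ennreal (3 powr \<alpha>) * ennreal (2 * d)"
    unfolding M by (intro add_mono mult_left_mono C_compl) auto
  also have "\<dots> = ennreal (\<eta> powr \<alpha> * M + 3 powr \<alpha> * (2 * d))"
    using M d by (simp add: ennreal_mult)
  also have "\<dots> < ennreal e"
    using \<eta>_M e by (intro ennreal_lessI) (auto simp: d_def field_simps)
  finally show "\<exists>q\<in>trig_polynomials H. Lpow \<alpha> \<mu> (\<lambda>\<gamma>. indicator B \<gamma> - q \<gamma>) < ennreal e"
    using p(1) by (auto simp: real_trig_polynomials_def)
qed

section \<open>Almost everywhere convergence\<close>

text \<open>The \<open>\<alpha>\<close>-th powers of the errors tend to zero in \<open>L\<^sup>1\<close>, so the corresponding fact about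
  \<open>L\<^sup>1\<close> gives the subsequence for every \<open>\<alpha> > 0\<close>.\<close>

lemma Lconverges_AE_subseq:
  assumes f: "f \<in> Lspace \<alpha> \<mu>" and p: "\<And>n. p n \<in> Lspace \<alpha> \<mu>" and \<alpha>: "0 < \<alpha>"
    and conv: "Lconverges \<alpha> \<mu> p f"
  obtains r :: "nat \<Rightarrow> nat" where "AE x in \<mu>. (\<lambda>n. p (r n) x) \<longlonglongrightarrow> f x"
proof -
  have [measurable]: "f \<in> borel_measurable \<mu>" "p n \<in> borel_measurable \<mu>" for n
    using f p by (auto simp: Lspace_def)
  define u where "u n x = norm (p n x - f x) powr \<alpha>" for n x
  have [measurable]: "u n \<in> borel_measurable \<mu>" for n
    unfolding u_def by measurable
  have "Lpow \<alpha> \<mu> (\<lambda>x. p n x + (- 1) * f x) \<le>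
      ennreal (2 powr \<alpha>) * (Lpow \<alpha> \<mu> (p n) + Lpow \<alpha> \<mu> (\<lambda>x. (- 1) * f x))" for n
    by (rule Lpow_add_le) (use \<alpha> in measurable)
  also have "\<dots> n < \<infinity>" for n
    using f p by (simp add: Lspace_def Lpow_def ennreal_mult_less_top)
  finally have fin: "(\<integral>\<^sup>+x. ennreal (u n x) \<partial>\<mu>) < \<infinity>" for n
    by (simp add: Lpow_def u_def)
  have int: "integrable \<mu> (u n)" for n
    using fin[of n] by (intro integrableI_nonneg) (auto simp: u_def)
  have "ennreal (\<integral>x. norm (u n x) \<partial>\<mu>) = (\<integral>\<^sup>+x. ennreal (u n x) \<partial>\<mu>)" for n
    using nn_integral_eq_integral[OF int[of n]] by (simp add: u_def[abs_def])
  then have "(\<lambda>n. ennreal (\<integral>x. norm (u n x) \<partial>\<mu>)) \<longlonglongrightarrow> ennreal 0"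
    using conv by (simp add: Lconverges_def u_def)
  then have "(\<lambda>n. \<integral>x. norm (u n x) \<partial>\<mu>) \<longlonglongrightarrow> 0"
    by (subst (asm) tendsto_ennreal_iff) auto
  from tendsto_L1_AE_subseq[OF int this] obtain r :: "nat \<Rightarrow> nat"
    where r: "AE x in \<mu>. (\<lambda>n. u (r n) x) \<longlonglongrightarrow> 0" by blast
  have "AE x in \<mu>. (\<lambda>n. p (r n) x) \<longlonglongrightarrow> f x"
    using r
  proof eventually_elim
    case (elim x)
    then have "(\<lambda>n. u (r n) x powr (1 / \<alpha>)) \<longlonglongrightarrow> 0 powr (1 / \<alpha>)"
      using \<alpha> by (intro tendsto_powr') (auto simp: u_def)
    then have "(\<lambda>n. norm (p (r n) x - f x)) \<longlonglongrightarrow> 0"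
      using \<alpha> by (simp add: u_def powr_powr)
    then show ?case
      by (simp add: tendsto_norm_zero_iff LIM_zero_iff)
  qed
  then show ?thesis by (rule that)
qed

text \<open>The function \<open>g\<close> that detects the translation depends on \<open>l\<close>: on a dual group that is not second
  countable there need not be one Borel function that separates all points. Choosing \<open>g\<close> separately
  for each \<open>l\<close> is affordable because there are only countably many of them.\<close>

lemma disjoint_translate_of_dense:
  fixes \<mu> :: "'a::topological_ab_group_add dual measure"
  assumes "finite_measure \<mu>" and sets: "sets \<mu> = sets borel" and \<alpha>: "0 < \<alpha>"
    and dense: "dense_in_Lspace \<alpha> \<mu> (trig_polynomials H)"
    and l: "l \<in> annihilator H" "l \<noteq> 0"
  obtains D where "D \<in> sets borel" "emeasure \<mu> (UNIV - D) = 0" "D \<inter> (+) l ` D = {}"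
proof -
  have space: "space \<mu> = UNIV" using sets_eq_imp_space_eq[OF sets] by simp
  have "pairing l \<noteq> pairing 0" using l(2) by (simp add: pairing_inject)
  then obtain x where x: "pairing l x \<noteq> 1"
    by (auto simp: fun_eq_iff zero_dual.rep_eq)
  define g where "g \<gamma> = pairing \<gamma> x" for \<gamma> :: "'a dual"
  have "g \<in> Lspace \<alpha> \<mu>"
    using trig_polynomials_subset_Lspace[OF assms(1) sets \<alpha>, of UNIV]
      trig_polynomials_monomial[of x UNIV 1] by (auto simp: g_def[abs_def])
  then obtain p where p: "\<And>n. p n \<in> trig_polynomials H" "Lconverges \<alpha> \<mu> p g"
    using dense unfolding dense_in_Lspace_def by blast
  obtain r where "AE \<gamma> in \<mu>. (\<lambda>n. p (r n) \<gamma>) \<longlonglongrightarrow> g \<gamma>"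
    using Lconverges_AE_subseq[OF \<open>g \<in> Lspace \<alpha> \<mu>\<close> _ \<alpha> p(2)] p(1)
      trig_polynomials_subset_Lspace[OF assms(1) sets \<alpha>, of H] by (metis subsetD)
  then obtain N where N: "{\<gamma> \<in> space \<mu>. \<not> (\<lambda>n. p (r n) \<gamma>) \<longlonglongrightarrow> g \<gamma>} \<subseteq> N"
      "emeasure \<mu> N = 0" "N \<in> sets \<mu>"
    by (rule AE_E)
  show ?thesis
  proof
    show "UNIV - N \<in> sets borel" using N(3) sets by auto
    show "emeasure \<mu> (UNIV - (UNIV - N)) = 0" using N(2) by (simp add: double_diff)
    have False if "\<gamma> \<notin> N" "l + \<gamma> \<notin> N" for \<gamma>
    proof -
      have "(\<lambda>n. p (r n) \<gamma>) \<longlonglongrightarrow> g \<gamma>" "(\<lambda>n. p (r n) (l + \<gamma>)) \<longlonglongrightarrow> g (l + \<gamma>)"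
        using N(1) that by (auto simp: space)
      then have "g (l + \<gamma>) = g \<gamma>"
        using trig_polynomial_annihilator_invariant[OF p(1) l(1)] LIMSEQ_unique by simp
      then show False using x by (simp add: g_def plus_dual.rep_eq)
    qed
    then show "(UNIV - N) \<inter> (+) l ` (UNIV - N) = {}" by auto
  qed
qed

theorem theorem4p5:
  fixes H :: "'a::{topological_ab_group_add, t2_space} set"
    and \<mu> :: "'a dual measure"
    and \<alpha> :: real
  assumes "locally_compact_space (euclidean :: 'a topology)"
    and "add_subgroup H" and "closed H"
    and "finite_measure \<mu>" and "regular_borel_measure \<mu>"
    and "0 < \<alpha>"
    and "countable (annihilator H)"
  shows "dense_in_Lspace \<alpha> \<mu> (trig_polynomials H) \<longleftrightarrow>
         concentrated_on_transversal (annihilator H) \<mu>"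
proof
  have sets: "sets \<mu> = sets borel"
    using assms(5) by (simp add: regular_borel_measure_def)
  have sub: "trig_polynomials H \<subseteq> Lspace \<alpha> \<mu>"
    by (rule trig_polynomials_subset_Lspace[OF assms(4) sets assms(6)])
  show "dense_in_Lspace \<alpha> \<mu> (trig_polynomials H)"
    if transversal: "concentrated_on_transversal (annihilator H) \<mu>"
  proof (rule dense_in_LspaceI[OF sub], rule Lspace_subset_Lclosure_indicator[OF assms(6)])
    obtain D where D: "D \<in> sets borel" "emeasure \<mu> (UNIV - D) = 0"
        "\<And>l. l \<in> annihilator H \<Longrightarrow> l \<noteq> 0 \<Longrightarrow> D \<inter> (+) l ` D = {}"
      using transversal unfolding concentrated_on_transversal_def by blast
    show "indicator B \<in> Lclosure \<alpha> \<mu> (trig_polynomials H)" if B: "B \<in> sets \<mu>" for B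
      by (rule indicator_in_Lclosure_trig_polynomials[OF assms(2,4,5,6) D B])
    show "trig_polynomials H \<subseteq> borel_measurable \<mu>"
      using sub by (auto simp: Lspace_def)
    show "(\<lambda>\<gamma>. p \<gamma> + q \<gamma>) \<in> trig_polynomials H"
      if "p \<in> trig_polynomials H" "q \<in> trig_polynomials H" for p q
      using that by (rule trig_polynomials_add)
    show "(\<lambda>\<gamma>. c * p \<gamma>) \<in> trig_polynomials H" if "p \<in> trig_polynomials H" for p c
      using that by (rule trig_polynomials_scale)
  qed
  show "concentrated_on_transversal (annihilator H) \<mu>"
    if dense: "dense_in_Lspace \<alpha> \<mu> (trig_polynomials H)"
  proof -
    let ?L = "annihilator H - {0}"
    have "\<forall>l\<in>?L. \<exists>D. D \<in> sets borel \<and> emeasure \<mu> (UNIV - D) = 0 \<and> D \<inter> (+) l ` D = {}"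
    proof
      fix l assume "l \<in> ?L"
      then have l: "l \<in> annihilator H" "l \<noteq> 0" by auto
      show "\<exists>D. D \<in> sets borel \<and> emeasure \<mu> (UNIV - D) = 0 \<and> D \<inter> (+) l ` D = {}"
        by (rule disjoint_translate_of_dense[OF assms(4) sets assms(6) dense l]) blast
    qed
    then obtain D where D: "\<And>l. l \<in> ?L \<Longrightarrow> D l \<in> sets borel"
        "\<And>l. l \<in> ?L \<Longrightarrow> emeasure \<mu> (UNIV - D l) = 0" "\<And>l. l \<in> ?L \<Longrightarrow> D l \<inter> (+) l ` D l = {}"
      by metis
    have "countable ?L" using assms(7) by simp
    have null: "(\<Union>l\<in>?L. UNIV - D l) \<in> null_sets \<mu>"
      using D(1,2) by (intro null_sets_UN' \<open>countable ?L\<close>) (auto simp: null_sets_def sets)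
    have eq: "UNIV - (UNIV - (\<Union>l\<in>?L. UNIV - D l)) = (\<Union>l\<in>?L. UNIV - D l)" by blast
    show ?thesis
      unfolding concentrated_on_transversal_def
    proof (intro bexI[of _ "UNIV - (\<Union>l\<in>?L. UNIV - D l)"] conjI ballI)
      show "emeasure \<mu> (UNIV - (UNIV - (\<Union>l\<in>?L. UNIV - D l))) = 0"
        unfolding eq using null by (rule null_setsD1)
      show "(UNIV - (\<Union>l\<in>?L. UNIV - D l)) \<inter> (+) l ` (UNIV - (\<Union>l\<in>?L. UNIV - D l)) = {}"
        if "l \<in> ?L" for l
        using D(3)[OF that] that by blast
      show "UNIV - (\<Union>l\<in>?L. UNIV - D l) \<in> sets borel"
        using null_setsD2[OF null] sets by auto
    qed
  qed
qed

end
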